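(* Let $g:\mathbb{N}\to\mathbb{N}$ be a function with inverse $g^{-1}$, and let $\Pi$ be a $g(r)$-minor-bidimensional problem. Then the $k$-$\Pi$ problem on graphs with $n$ vertices can be solved by a deterministic one-pass streaming algorithm using $O((g^{-1}(k+1))^{10}\cdot n)$ space in insertion-only streams and $\widetilde{O}((g^{-1}(k+1))^{10}\cdot n)$ space in insertion-deletion streams.
   Context: A graph problem $\Pi$ assigns to each undirected graph a nonnegative integer value and is either a minimization or a maximization problem; $k$-$\Pi$ asks, for a graph $G$ and integer $k$, whether the value of $\Pi$ on $G$ is at most $k$ (minimization) or at least $k$ (maximization). $H$ is a minor of $G$ if $H$ can be obtained from $G$ by vertex deletions, edge deletions and edge contractions. $\Pi$ is $g(r)$-minor-bidimensional if (i) its value on the $r\times r$ grid is at least $g(r)$, and (ii) its value does not increase under vertex deletions, edge deletions and edge contractions. Streaming model: the $n$ vertices are fixed, edges arrive one by one (insertion-only: only insertions; insertion-deletion: insertions and deletions). Space is measured in words of $O(\log n)$ bits; $\widetilde{O}$ hides $\log^{O(1)} n$ factors; unbounded computation is allowed. *)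

theory Defs
  imports Complex_Main
begin

type_synonym 'a ugraph = "'a set \<times> 'a set set"

abbreviation verts :: "'a ugraph \<Rightarrow> 'a set" where "verts \<equiv> fst"
abbreviation edges :: "'a ugraph \<Rightarrow> 'a set set" where "edges \<equiv> snd"

definition all_edges :: "'a set \<Rightarrow> 'a set set" where
  "all_edges V = {e. e \<subseteq> V \<and> card e = 2}"

definition ugraph :: "'a ugraph \<Rightarrow> bool" where
  "ugraph G \<longleftrightarrow> finite (verts G) \<and> edges G \<subseteq> all_edges (verts G)"

definition delete_vertex :: "'a \<Rightarrow> 'a ugraph \<Rightarrow> 'a ugraph" where
  "delete_vertex v G = (verts G - {v}, {e \<in> edges G. v \<notin> e})"

definition delete_edge :: "'a set \<Rightarrow> 'a ugraph \<Rightarrow> 'a ugraph" where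
  "delete_edge e G = (verts G, edges G - {e})"

text \<open>Contraction of the edge \<open>{u, v}\<close>: the merged vertex keeps the name \<open>u\<close>; the loop \<open>{u}\<close>
  arising from the contracted edge is dropped, and parallel edges are identified.\<close>

definition contract_edge :: "'a \<Rightarrow> 'a \<Rightarrow> 'a ugraph \<Rightarrow> 'a ugraph" where
  "contract_edge u v G =
     (verts G - {v}, (\<lambda>e. (\<lambda>x. if x = v then u else x) ` e) ` edges G - {{u}})"

definition isomorphic :: "'a ugraph \<Rightarrow> 'b ugraph \<Rightarrow> bool" where
  "isomorphic G H \<longleftrightarrow>
     (\<exists>f. bij_betw f (verts G) (verts H) \<and> edges H = (\<lambda>e. f ` e) ` edges G)"

definition grid :: "nat \<Rightarrow> (nat \<times> nat) ugraph" where
  "grid r =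
     ({..<r} \<times> {..<r},
      {{(i, j), (i, Suc j)} | i j. i < r \<and> Suc j < r} \<union>
      {{(i, j), (Suc i, j)} | i j. Suc i < r \<and> j < r})"

datatype goal = Minimization | Maximization

text \<open>Every finite graph is isomorphic to one whose vertices are natural numbers, so problems
  are functions on the latter. Only the values on arguments satisfying \<^const>\<open>ugraph\<close> matter.\<close>

record graph_problem =
  goal :: goal
  val :: "nat ugraph \<Rightarrow> nat"

definition k_problem :: "graph_problem \<Rightarrow> nat \<Rightarrow> nat ugraph \<Rightarrow> bool" where
  "k_problem P k G \<longleftrightarrow>
     (case goal P of Minimization \<Rightarrow> val P G \<le> k | Maximization \<Rightarrow> k \<le> val P G)"

text \<open>The \<open>r \<times> r\<close> grid stands for any graph isomorphic to \<^term>\<open>grid r\<close>. No invariance of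
  \<^const>\<open>val\<close> under isomorphism is required beyond this.\<close>

definition minor_bidimensional :: "(nat \<Rightarrow> nat) \<Rightarrow> graph_problem \<Rightarrow> bool" where
  "minor_bidimensional g P \<longleftrightarrow>
     (\<forall>r G. ugraph G \<and> isomorphic (grid r) G \<longrightarrow> g r \<le> val P G) \<and>
     (\<forall>G. ugraph G \<longrightarrow>
        (\<forall>v \<in> verts G. val P (delete_vertex v G) \<le> val P G) \<and>
        (\<forall>e \<in> edges G. val P (delete_edge e G) \<le> val P G) \<and>
        (\<forall>u v. {u, v} \<in> edges G \<longrightarrow> val P (contract_edge u v G) \<le> val P G))"

text \<open>Bounds such as \<open>g r = r\<^sup>2 div 2\<close> are not bijections on the natural numbers, so their
  inverse is understood with rounding: \<open>h m\<close> is an argument at which \<open>g\<close> reaches \<open>m\<close>. The lemmas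
  below show that this covers exact inverses as well as the least such argument.\<close>

definition inverse_bound :: "(nat \<Rightarrow> nat) \<Rightarrow> (nat \<Rightarrow> nat) \<Rightarrow> bool" where
  "inverse_bound g h \<longleftrightarrow> (\<forall>m. m \<le> g (h m))"

lemma inverse_bound_inv: "bij g \<Longrightarrow> inverse_bound g (inv g)"
  by (simp add: inverse_bound_def bij_is_surj surj_f_inv_f)

lemma inverse_bound_right_inverse: "(\<And>m. g (h m) = m) \<Longrightarrow> inverse_bound g h"
  by (simp add: inverse_bound_def)

lemma inverse_bound_Least:
  assumes "\<And>m. \<exists>r. m \<le> g r"
  shows "inverse_bound g (\<lambda>m. LEAST r. m \<le> g r)"
  unfolding inverse_bound_def using LeastI_ex[OF assms] by simp

datatype item = Ins "nat set" | Del "nat set"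

fun apply_item :: "nat set set \<Rightarrow> item \<Rightarrow> nat set set" where
  "apply_item E (Ins e) = insert e E"
| "apply_item E (Del e) = E - {e}"

definition stream_graph :: "nat \<Rightarrow> item list \<Rightarrow> nat ugraph" where
  "stream_graph n xs = ({..<n}, foldl apply_item {} xs)"

definition insertion_only_stream :: "nat \<Rightarrow> item list \<Rightarrow> bool" where
  "insertion_only_stream n xs \<longleftrightarrow> set xs \<subseteq> Ins ` all_edges {..<n}"

text \<open>The graph is simple at all times: only absent edges are inserted, and only present edges
  are deleted.\<close>

fun legal_item :: "nat \<Rightarrow> nat set set \<Rightarrow> item \<Rightarrow> bool" where
  "legal_item n E (Ins e) \<longleftrightarrow> e \<in> all_edges {..<n} \<and> e \<notin> E"
| "legal_item n E (Del e) \<longleftrightarrow> e \<in> E"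

definition insertion_deletion_stream :: "nat \<Rightarrow> item list \<Rightarrow> bool" where
  "insertion_deletion_stream n xs \<longleftrightarrow>
     (\<forall>i < length xs. legal_item n (edges (stream_graph n (take i xs))) (xs ! i))"

text \<open>The memory content between two stream items is a bit string. Computation is unbounded, so
  the functions below are arbitrary; an algorithm may depend on \<open>n\<close> and \<open>k\<close>, which are known in
  advance.\<close>

record streaming_algorithm =
  init :: "bool list"
  step :: "bool list \<Rightarrow> item \<Rightarrow> bool list"
  answer :: "bool list \<Rightarrow> bool"

definition run :: "streaming_algorithm \<Rightarrow> item list \<Rightarrow> bool list" where
  "run A xs = foldl (step A) (init A) xs"

text \<open>Agrees with the binary logarithm for \<open>n \<ge> 2\<close>.\<close>

definition lg :: "nat \<Rightarrow> real" where
  "lg n = max 1 (log 2 (real n))"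

text \<open>\<open>s n k\<close> counts words of \<^term>\<open>lg n\<close> bits, and the memory content is bounded
  throughout the pass.\<close>

definition solvable_in_space ::
  "(nat \<Rightarrow> item list \<Rightarrow> bool) \<Rightarrow> graph_problem \<Rightarrow> (nat \<Rightarrow> nat \<Rightarrow> real) \<Rightarrow> bool" where
  "solvable_in_space valid P s \<longleftrightarrow>
     (\<exists>A :: nat \<Rightarrow> nat \<Rightarrow> streaming_algorithm. \<forall>n k xs. valid n xs \<longrightarrow>
        (\<forall>i \<le> length xs. real (length (run (A n k) (take i xs))) \<le> s n k * lg n) \<and>
        (answer (A n k) (run (A n k) xs) \<longleftrightarrow> k_problem P k (stream_graph n xs)))"

end

theory Submission imports Defs begin

text \<open>With \<open>r = g\<^sup>-\<^sup>1(k + 1)\<close>, every graph on \<open>n\<close> vertices with at least \<open>9 r\<^sup>4 n\<close> edges contains the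
  \<open>r \<times> r\<close> grid as a minor, hence has value greater than \<open>k\<close>, and the answer does not depend on it.
  For \<open>d = 9 r\<^sup>4\<close>, pass to a minimal minor with at least \<open>d\<close> times as many edges as vertices: every
  edge lies in \<open>d\<close> triangles and some vertex has degree at most \<open>2 d\<close>. Any three vertices of its
  neighbourhood \<open>H\<close> have at least \<open>d\<close> neighbours each among the at most \<open>2 d\<close> vertices of \<open>H\<close>, so
  two of them share \<open>d / 3\<close> neighbours. Pairs with fewer common neighbours thus form a triangle-free
  graph, which has an independent set of size \<open>r\<^sup>2\<close>; joining its elements through distinct common
  neighbours yields the grid. This replaces the polynomial grid-minor theorem.

  It remains to know the edge set when it has fewer than \<open>m = 9 r\<^sup>4 n\<close> elements. Without deletions
  it is stored explicitly until it becomes too large. With deletions, one keeps the number of edges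
  and the sum of edge weights modulo \<open>M\<close>, for weights such that distinct sets of at most \<open>m\<close> edges
  have distinct sums; a greedy choice succeeds for some \<open>M\<close> with \<open>O(m log n)\<close> bits.\<close>

section \<open>Monotonicity under minors\<close>

definition nbrs :: "'a set set \<Rightarrow> 'a \<Rightarrow> 'a set" where
  "nbrs E v = {w. {v, w} \<in> E}"

lemma all_edges_iff: "{x, y} \<in> all_edges V \<longleftrightarrow> x \<in> V \<and> y \<in> V \<and> x \<noteq> y"
  by (auto simp: all_edges_def card_insert_if)

lemma all_edgesE:
  assumes "e \<in> all_edges V"
  obtains x y where "e = {x, y}" "x \<in> V" "y \<in> V" "x \<noteq> y"
  using assms by (auto simp: all_edges_def card_2_iff)

lemma finite_all_edges: "finite V \<Longrightarrow> finite (all_edges V)"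
  by (auto simp: all_edges_def intro: finite_subset[of _ "Pow V"])

lemma ugraph_finite_edges: "ugraph (V, E) \<Longrightarrow> finite E"
  by (auto simp: ugraph_def intro: finite_subset finite_all_edges)

lemma ugraph_edgeD: "ugraph (V, E) \<Longrightarrow> {x, y} \<in> E \<Longrightarrow> x \<in> V \<and> y \<in> V \<and> x \<noteq> y"
  using all_edges_iff[of x y V] by (auto simp: ugraph_def)

lemma ugraph_edgeE:
  assumes "ugraph (V, E)" "e \<in> E"
  obtains x y where "e = {x, y}" "x \<in> V" "y \<in> V" "x \<noteq> y"
proof -
  have "e \<in> all_edges V"
    using assms by (auto simp: ugraph_def)
  then show ?thesis
    using that by (rule all_edgesE)
qed

lemma nbrs_subset: "ugraph (V, E) \<Longrightarrow> nbrs E v \<subseteq> V"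
  by (auto simp: nbrs_def dest: ugraph_edgeD)

lemma finite_nbrs: "ugraph (V, E) \<Longrightarrow> finite (nbrs E v)"
  by (rule finite_subset[OF nbrs_subset]) (auto simp: ugraph_def)

lemma ugraph_subset: "ugraph (V, E) \<Longrightarrow> E' \<subseteq> E \<Longrightarrow> ugraph (V, E')"
  by (auto simp: ugraph_def)

lemma ugraph_delete_vertex: "ugraph G \<Longrightarrow> ugraph (delete_vertex v G)"
  by (auto simp: ugraph_def delete_vertex_def all_edges_def)

lemma edges_contract_edgeI:
  assumes "e \<in> E" "(\<lambda>x. if x = v then u else x) ` e = e'" "e' \<noteq> {u}"
  shows "e' \<in> edges (contract_edge u v (V, E))"
  unfolding contract_edge_def snd_conv Diff_iff singleton_iff
  using imageI[OF assms(1), of "\<lambda>e. (\<lambda>x. if x = v then u else x) ` e"] assms(2,3) by simp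

lemma contract_edge_image:
  assumes "ugraph (V, E)" "e \<in> E" "v \<notin> e"
  shows "e \<in> edges (contract_edge u v (V, E))"
proof -
  have "(\<lambda>x. if x = v then u else x) ` e = e"
    using assms(3) by (auto simp: image_iff)
  moreover have "e \<noteq> {u}"
    using assms(1,2) by (auto simp: ugraph_def all_edges_def)
  ultimately show ?thesis
    by (rule edges_contract_edgeI[OF assms(2)])
qed

lemma contract_edge_redirect:
  assumes "ugraph (V, E)" "{v, w} \<in> E" "w \<noteq> u"
  shows "{u, w} \<in> edges (contract_edge u v (V, E))"
proof -
  have "w \<noteq> v"
    using ugraph_edgeD[OF assms(1,2)] by auto
  then have "(\<lambda>x. if x = v then u else x) ` {v, w} = {u, w}"
    by auto
  moreover have "{u, w} \<noteq> {u}"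
    using assms(3) by auto
  ultimately show ?thesis
    by (rule edges_contract_edgeI[OF assms(2)])
qed

lemma ugraph_contract_edge:
  assumes "ugraph (V, E)" "{u, v} \<in> E"
  shows "ugraph (contract_edge u v (V, E))"
proof -
  let ?f = "\<lambda>x. if x = v then u else x"
  have uv: "u \<in> V" "v \<in> V" "u \<noteq> v"
    using ugraph_edgeD[OF assms] by auto
  have "?f ` e \<in> all_edges (V - {v})" if e: "e \<in> E" "?f ` e \<noteq> {u}" for e
  proof -
    obtain x y where xy: "e = {x, y}" "x \<in> V" "y \<in> V" "x \<noteq> y"
      using ugraph_edgeE[OF assms(1) e(1)] .
    have "?f ` e = {?f x, ?f y}"
      using xy by simp
    also have "{?f x, ?f y} \<in> all_edges (V - {v})"
      unfolding all_edges_iff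
    proof (intro conjI)
      \<comment> \<open>The renaming identifies only \<open>u\<close> and \<open>v\<close>, so equal
        images would produce the excluded loop \<open>{u}\<close>.\<close>
      show "?f x \<noteq> ?f y"
        using xy e(2) by (auto split: if_splits)
    qed (use xy uv in auto)
    finally show ?thesis .
  qed
  then show ?thesis
    using assms(1) unfolding ugraph_def contract_edge_def by auto
qed

section \<open>Values of subgraphs and of graphs obtained by contracting common neighbours\<close>

lemma minor_bidimensionalD:
  assumes "minor_bidimensional g P"
  shows "ugraph G \<Longrightarrow> isomorphic (grid r) G \<Longrightarrow> g r \<le> val P G"
    and "ugraph G \<Longrightarrow> v \<in> verts G \<Longrightarrow> val P (delete_vertex v G) \<le> val P G"
    and "ugraph G \<Longrightarrow> e \<in> edges G \<Longrightarrow> val P (delete_edge e G) \<le> val P G"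
    and "ugraph G \<Longrightarrow> {u, w} \<in> edges G \<Longrightarrow> val P (contract_edge u w G) \<le> val P G"
  using assms unfolding minor_bidimensional_def by blast+

lemma val_delete_edges:
  assumes "minor_bidimensional g P" "ugraph (V, E)" "finite D" "D \<subseteq> E"
  shows "val P (V, E - D) \<le> val P (V, E)"
  using assms(3,4)
proof (induction D rule: finite_induct)
  case (insert e D)
  have "delete_edge e (V, E - D) = (V, E - insert e D)"
    by (auto simp: delete_edge_def)
  moreover have "val P (delete_edge e (V, E - D)) \<le> val P (V, E - D)"
    using insert minor_bidimensionalD(3)[OF assms(1) ugraph_subset[OF assms(2)]] by auto
  ultimately show ?case
    using insert by auto
qed simp

text \<open>Edges at \<open>D\<close> are assumed absent, so each deletion removes an isolated
  vertex and the edge set stays the same.\<close>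

lemma val_delete_vertices:
  assumes "minor_bidimensional g P" "ugraph (V, E)" "finite D" "D \<subseteq> V" "E \<subseteq> all_edges (V - D)"
  shows "val P (V - D, E) \<le> val P (V, E)"
  using assms(3,4,5)
proof (induction D rule: finite_induct)
  case (insert v D)
  have E: "E \<subseteq> all_edges (V - D)"
    using insert.prems by (auto simp: all_edges_def)
  have "delete_vertex v (V - D, E) = (V - insert v D, E)"
    using insert.prems by (auto simp: delete_vertex_def all_edges_def)
  moreover have "val P (delete_vertex v (V - D, E)) \<le> val P (V - D, E)"
    using insert E assms(2) by (intro minor_bidimensionalD(2)[OF assms(1)]) (auto simp: ugraph_def)
  ultimately show ?case
    using insert E by auto
qed simp

text \<open>Surplus edges go first, which isolates the vertices outside \<open>U\<close>.\<close>

lemma val_subgraph: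
  assumes "minor_bidimensional g P" "ugraph (V, E)" "U \<subseteq> V" "T \<subseteq> E" "T \<subseteq> all_edges U"
  shows "val P (U, T) \<le> val P (V, E)"
proof -
  have "finite V" "finite E"
    using assms(2) ugraph_finite_edges by (auto simp: ugraph_def)
  then have "val P (V - (V - U), T) \<le> val P (V, T)"
    using assms by (intro val_delete_vertices[OF assms(1)] ugraph_subset[OF assms(2)])
      (auto simp: double_diff)
  moreover have "val P (V, E - (E - T)) \<le> val P (V, E)"
    using \<open>finite E\<close> by (intro val_delete_edges[OF assms(1,2)]) auto
  ultimately show ?thesis
    using assms(3,4) by (simp add: double_diff)
qed

text \<open>Contracting a common neighbour \<open>w \<notin> U\<close> of \<open>x\<close> and \<open>y\<close> into \<open>x\<close> creates the edge
  \<open>{x, y}\<close> and costs every other missing edge at most one common neighbour.\<close>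

lemma val_connect:
  assumes mb: "minor_bidimensional g P"
    and "finite F" "ugraph (V, E)" "U \<subseteq> V" "T \<subseteq> all_edges U" "F \<subseteq> T" "T - F \<subseteq> E"
    and "\<And>x y. {x, y} \<in> F \<Longrightarrow> card F \<le> card (nbrs E x \<inter> nbrs E y - U)"
  shows "val P (U, T) \<le> val P (V, E)"
  using assms(2-)
proof (induction F arbitrary: V E rule: finite_induct)
  case empty
  then show ?case
    using val_subgraph[OF mb] by auto
next
  case (insert e F)
  obtain x y where xy: "e = {x, y}" "x \<in> U" "y \<in> U" "x \<noteq> y"
    using insert.prems all_edgesE[of e U] by (metis insert_subset subset_iff)
  have "Suc (card F) \<le> card (nbrs E x \<inter> nbrs E y - U)"
    using insert.prems(6)[of x y] insert.hyps xy by simp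
  then have "nbrs E x \<inter> nbrs E y - U \<noteq> {}"
    by (metis card.empty not_less_eq_eq zero_le)
  then obtain w where w: "{x, w} \<in> E" "{y, w} \<in> E" "w \<notin> U"
    by (auto simp: nbrs_def)
  define E' where "E' = edges (contract_edge x w (V, E))"
  have G': "contract_edge x w (V, E) = (V - {w}, E')"
    by (simp add: E'_def contract_edge_def)
  have keep: "a \<in> E'" if "a \<in> E" "w \<notin> a" for a
    unfolding E'_def using contract_edge_image[OF insert.prems(1) that] .
  have "{x, y} \<in> E'"
    unfolding E'_def using w xy
    by (intro contract_edge_redirect[OF insert.prems(1)]) (auto simp: insert_commute)
  moreover have "a \<in> E'" if "a \<in> T - insert e F" for a
    using that insert.prems w by (intro keep) (auto simp: all_edges_def)
  ultimately have TF: "T - F \<subseteq> E'"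
    using xy by auto
  \<comment> \<open>Edges avoiding \<open>w\<close> survive, and \<open>a\<close>, \<open>b\<close>
    lie in \<open>U\<close> while \<open>w\<close> does not. Only \<open>w\<close> itself can be
    lost, which matches the drop of \<open>card F\<close> by one.\<close>
  have nb: "card F \<le> card (nbrs E' a \<inter> nbrs E' b - U)" if "{a, b} \<in> F" for a b
  proof -
    have ug': "ugraph (V - {w}, E')"
      using ugraph_contract_edge[OF insert.prems(1) w(1)] G' by simp
    have "{a, b} \<in> all_edges U"
      using that insert.prems by auto
    then have ab: "a \<in> U" "b \<in> U"
      by (auto simp: all_edges_iff)
    have "Suc (card F) \<le> card (nbrs E a \<inter> nbrs E b - U)"
      using insert.prems(6)[of a b] insert.hyps that by simp
    then have "card F \<le> card (nbrs E a \<inter> nbrs E b - U - {w})"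
      by (auto simp: card_Diff_singleton_if)
    also have "\<dots> \<le> card (nbrs E' a \<inter> nbrs E' b - U)"
      using ab w keep finite_nbrs[OF ug'] by (intro card_mono) (auto simp: nbrs_def)
    finally show ?thesis .
  qed
  have "val P (U, T) \<le> val P (V - {w}, E')"
    using insert.prems w TF nb ugraph_contract_edge[OF insert.prems(1) w(1)]
    by (intro insert.IH) (auto simp: G')
  also have "\<dots> \<le> val P (V, E)"
    using minor_bidimensionalD(4)[OF mb insert.prems(1), of x w] w by (simp add: G')
  finally show ?case .
qed

section \<open>Dense graphs contain large grids as minors\<close>

lemma card_incident_edges:
  assumes "ugraph (V, E)"
  shows "card {e \<in> E. v \<in> e} = card (nbrs E v)"
proof -
  have "{e \<in> E. v \<in> e} = (\<lambda>w. {v, w}) ` nbrs E v"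
  proof -
    have "e \<in> (\<lambda>w. {v, w}) ` nbrs E v" if e: "e \<in> E" "v \<in> e" for e
    proof -
      obtain x y where "e = {x, y}"
        using ugraph_edgeE[OF assms e(1)] by metis
      then show ?thesis
        using e by (auto simp: nbrs_def insert_commute)
    qed
    then show ?thesis
      by (auto simp: nbrs_def)
  qed
  moreover have "inj_on (\<lambda>w. {v, w}) (nbrs E v)"
    by (auto simp: inj_on_def doubleton_eq_iff)
  ultimately show ?thesis
    by (simp add: card_image)
qed

lemma handshake:
  assumes "ugraph (V, E)"
  shows "(\<Sum>v\<in>V. card (nbrs E v)) = 2 * card E"
proof -
  have "card {v \<in> V. v \<in> e} = 2" if "e \<in> E" for e
  proof -
    have "{v \<in> V. v \<in> e} = e"
      using assms that by (auto simp: ugraph_def all_edges_def)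
    then show ?thesis
      using assms that by (auto simp: ugraph_def all_edges_def)
  qed
  then have "(\<Sum>v\<in>V. card {e \<in> E. v \<in> e}) = 2 * card E"
    using assms ugraph_finite_edges[OF assms]
    by (intro sum_multicount) (auto simp: ugraph_def)
  then show ?thesis
    by (simp add: card_incident_edges[OF assms])
qed

lemma card_split_incident:
  assumes "ugraph (V, E)"
  shows "card E = card {e \<in> E. v \<notin> e} + card (nbrs E v)"
proof -
  have "card E = card ({e \<in> E. v \<notin> e} \<union> {e \<in> E. v \<in> e})"
    by (intro arg_cong[where f = card]) auto
  also have "\<dots> = card {e \<in> E. v \<notin> e} + card {e \<in> E. v \<in> e}"
    using ugraph_finite_edges[OF assms] by (intro card_Un_disjoint) auto
  finally show ?thesis
    by (simp add: card_incident_edges[OF assms])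
qed

text \<open>The losses are the contracted edge and, for each common neighbour, one of two edges that
  become parallel.\<close>

lemma card_edges_contract_edge:
  assumes "ugraph (V, E)" "{u, v} \<in> E"
  shows "card E \<le> card (edges (contract_edge u v (V, E))) + 1 + card (nbrs E u \<inter> nbrs E v)"
proof -
  let ?E' = "edges (contract_edge u v (V, E))"
  \<comment> \<open>Neighbours of \<open>v\<close> whose redirected edge is new: neither a loop nor
    an edge already present at \<open>u\<close>.\<close>
  let ?R = "nbrs E v - {u} - nbrs E u"
  have fin: "finite E" "finite ?E'" "finite (nbrs E v)"
    using ugraph_finite_edges[OF assms(1)] finite_nbrs[OF assms(1)]
    by (auto simp: contract_edge_def)
  have "{e \<in> E. v \<notin> e} \<union> (\<lambda>w. {u, w}) ` ?R \<subseteq> ?E'"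
    using contract_edge_image[OF assms(1)] contract_edge_redirect[OF assms(1)]
    by (auto simp: nbrs_def)
  then have "card ({e \<in> E. v \<notin> e} \<union> (\<lambda>w. {u, w}) ` ?R) \<le> card ?E'"
    using fin(2) by (rule card_mono[rotated])
  moreover have "card ({e \<in> E. v \<notin> e} \<union> (\<lambda>w. {u, w}) ` ?R) = card {e \<in> E. v \<notin> e} + card ?R"
  proof -
    have "inj_on (\<lambda>w. {u, w}) ?R"
      by (auto simp: inj_on_def doubleton_eq_iff)
    moreover have "{e \<in> E. v \<notin> e} \<inter> (\<lambda>w. {u, w}) ` ?R = {}"
      by (auto simp: nbrs_def)
    ultimately show ?thesis
      using fin by (subst card_Un_disjoint) (auto simp: card_image)
  qed
  moreover have "card (nbrs E v) \<le> card ?R + 1 + card (nbrs E u \<inter> nbrs E v)"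
  proof -
    have "card (nbrs E v) \<le> card (?R \<union> {u} \<union> (nbrs E u \<inter> nbrs E v))"
      using fin(3) by (intro card_mono) auto
    also have "\<dots> \<le> card (?R \<union> {u}) + card (nbrs E u \<inter> nbrs E v)"
      by (rule card_Un_le)
    also have "card (?R \<union> {u}) \<le> card ?R + 1"
      using card_Un_le[of ?R "{u}"] by simp
    finally show ?thesis
      by simp
  qed
  ultimately show ?thesis
    using card_split_incident[OF assms(1), of v] by linarith
qed

text \<open>The Ramsey bound R(3,t) <= t^2. The neighbours of a vertex are pairwise unrelated; if
  there are too few of them, the vertex joins an independent set found among its
  non-neighbours.\<close>

lemma triangle_free_independent:
  fixes R :: "'a \<Rightarrow> 'a \<Rightarrow> bool"
  assumes "finite A" "t\<^sup>2 \<le> card A" "symp R"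
    and "\<And>x y z. x \<in> A \<Longrightarrow> y \<in> A \<Longrightarrow> z \<in> A \<Longrightarrow> R x y \<Longrightarrow> R x z \<Longrightarrow> y \<noteq> z \<Longrightarrow> \<not> R y z"
  shows "\<exists>B \<subseteq> A. card B = t \<and> (\<forall>x\<in>B. \<forall>y\<in>B. x \<noteq> y \<longrightarrow> \<not> R x y)"
  using assms(1,2,4)
proof (induction t arbitrary: A)
  case 0
  then show ?case
    by (intro exI[of _ "{}"]) auto
next
  case (Suc t)
  then have "A \<noteq> {}"
    by auto
  then obtain v where v: "v \<in> A"
    by auto
  let ?N = "{w \<in> A. R v w}"
  show ?case
  proof (cases "Suc t \<le> card ?N")
    case True
    then obtain B where B: "B \<subseteq> ?N" "card B = Suc t"
      using obtain_subset_with_card_n by metis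
    moreover have "\<not> R x y" if "x \<in> B" "y \<in> B" "x \<noteq> y" for x y
      using Suc.prems(3)[of v x y] that B v by auto
    ultimately show ?thesis
      by (intro exI[of _ B]) auto
  next
    case False
    \<comment> \<open>The parts may overlap, since \<open>R v v\<close> is possible, but the union
      bound suffices: (t+1)^2 - t - 1 >= t^2.\<close>
    have "card A \<le> card ((A - ?N - {v}) \<union> ?N \<union> {v})"
      using Suc.prems by (intro card_mono) auto
    also have "\<dots> \<le> card (A - ?N - {v}) + card ?N + card {v}"
      by (meson add_mono card_Un_le le_refl le_trans)
    finally have "t\<^sup>2 \<le> card (A - ?N - {v})"
      using False Suc.prems(2) by (simp add: power2_eq_square)
    then have "\<exists>B \<subseteq> A - ?N - {v}. card B = t \<and> (\<forall>x\<in>B. \<forall>y\<in>B. x \<noteq> y \<longrightarrow> \<not> R x y)"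
    proof (rule Suc.IH[rotated])
      fix x y z
      assume "x \<in> A - ?N - {v}" "y \<in> A - ?N - {v}" "z \<in> A - ?N - {v}" "R x y" "R x z" "y \<noteq> z"
      then show "\<not> R y z"
        using Suc.prems(3)[of x y z] by blast
    qed (simp add: Suc.prems(1))
    then obtain B where B: "B \<subseteq> A - ?N - {v}" "card B = t"
        "\<forall>x\<in>B. \<forall>y\<in>B. x \<noteq> y \<longrightarrow> \<not> R x y"
      by blast
    have "finite B"
      using B(1) Suc.prems(1) by (meson finite_Diff finite_subset)
    moreover have "v \<notin> B"
      using B(1) by blast
    ultimately have "card (insert v B) = Suc t"
      using B(2) by simp
    moreover have "\<not> R v x \<and> \<not> R x v" if "x \<in> B" for x
      using that B(1) assms(3) by (auto dest: sympD)
    ultimately show ?thesis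
      using B v by (intro exI[of _ "insert v B"]) auto
  qed
qed

text \<open>Inclusion-exclusion truncated after the pairwise terms (Bonferroni), with the union
  bounded by \<open>H\<close>.\<close>

lemma card_three_sets:
  assumes "finite H" "A \<subseteq> H" "B \<subseteq> H" "C \<subseteq> H"
  shows "card A + card B + card C \<le>
    card H + card (A \<inter> B) + card (A \<inter> C) + card (B \<inter> C)"
proof -
  have fin: "finite A" "finite B" "finite C"
    using assms finite_subset by blast+
  have "card A + card B = card (A \<union> B) + card (A \<inter> B)"
    by (rule card_Un_Int[OF fin(1,2)])
  moreover have "card (A \<union> B) + card C = card (A \<union> B \<union> C) + card ((A \<union> B) \<inter> C)"
    using fin by (intro card_Un_Int) auto
  moreover have "card ((A \<union> B) \<inter> C) \<le> card (A \<inter> C) + card (B \<inter> C)"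
    by (simp add: Int_Un_distrib2 card_Un_le)
  moreover have "card (A \<union> B \<union> C) \<le> card H"
    using assms by (intro card_mono) auto
  ultimately show ?thesis
    by linarith
qed

section \<open>Grids from common neighbourhoods\<close>

lemma grid_edges: "edges (grid r) \<subseteq> all_edges (verts (grid r))"
  by (auto simp: grid_def all_edges_def)

lemma card_grid_edges: "card (edges (grid r)) \<le> 2 * r\<^sup>2"
proof -
  let ?Q = "{..<r} \<times> {..<r}"
  let ?h = "\<lambda>(i, j). {(i, j), (i, Suc j)}" and ?v = "\<lambda>(i, j). {(i, j), (Suc i, j)}"
  have "edges (grid r) \<subseteq> ?h ` ?Q \<union> ?v ` ?Q"
    by (fastforce simp: grid_def)
  then have "card (edges (grid r)) \<le> card (?h ` ?Q \<union> ?v ` ?Q)"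
    by (intro card_mono) auto
  also have "\<dots> \<le> card (?h ` ?Q) + card (?v ` ?Q)"
    by (rule card_Un_le)
  also have "\<dots> \<le> card ?Q + card ?Q"
    by (intro add_mono card_image_le) auto
  finally show ?thesis
    by (simp add: power2_eq_square)
qed

text \<open>Grid vertices are placed bijectively on \<open>U\<close>, and each grid edge is created
  by contracting its own common neighbour outside \<open>U\<close>. Of the 3r^2 common neighbours at
  most r^2 lie in \<open>U\<close>; the other 2r^2 serve the at most 2r^2 grid edges.\<close>

lemma val_ge_if_common_nbrs:
  assumes mb: "minor_bidimensional g P" and ug: "ugraph (V, E)"
    and U: "U \<subseteq> V" "card U = r\<^sup>2"
    and common: "\<And>x y. x \<in> U \<Longrightarrow> y \<in> U \<Longrightarrow> x \<noteq> y \<Longrightarrow> 3 * r\<^sup>2 \<le> card (nbrs E x \<inter> nbrs E y)"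
  shows "g r \<le> val P (V, E)"
proof -
  have finU: "finite U"
    using U ug finite_subset by (auto simp: ugraph_def)
  have "card (verts (grid r)) = card U" "finite (verts (grid r))"
    using U by (auto simp: grid_def power2_eq_square)
  then obtain f where f: "bij_betw f (verts (grid r)) U"
    using finU finite_same_card_bij by blast
  define T where "T = (\<lambda>e. f ` e) ` edges (grid r)"
  have TU: "T \<subseteq> all_edges U"
  proof
    fix a assume "a \<in> T"
    then obtain e where e: "e \<in> edges (grid r)" "a = f ` e"
      by (auto simp: T_def)
    then have "e \<subseteq> verts (grid r)" "card e = 2"
      using grid_edges by (auto simp: all_edges_def)
    moreover from this have "card (f ` e) = card e"
      using f by (meson bij_betw_def card_image inj_on_subset)
    ultimately show "a \<in> all_edges U"
      using f e by (auto simp: all_edges_def bij_betw_def)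
  qed
  have finT: "finite T"
    using TU finU finite_all_edges finite_subset by blast
  have "finite (edges (grid r))"
    using grid_edges[of r] finite_all_edges finite_subset \<open>finite (verts (grid r))\<close> by blast
  then have "card T \<le> 2 * r\<^sup>2"
    using card_grid_edges[of r] card_image_le le_trans unfolding T_def by blast
  have "val P (U, T) \<le> val P (V, E)"
  \<comment> \<open>Here \<open>F\<close> is all of \<open>T\<close>: no grid edge is assumed to be
    present in \<open>E\<close>.\<close>
  proof (rule val_connect[OF mb finT ug U(1) TU])
    fix x y assume "{x, y} \<in> T"
    then have "{x, y} \<in> all_edges U"
      using TU by (rule subsetD[rotated])
    then have "x \<in> U" "y \<in> U" "x \<noteq> y"
      by (simp_all add: all_edges_iff)
    then have "3 * r\<^sup>2 \<le> card (nbrs E x \<inter> nbrs E y)"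
      by (rule common)
    moreover have "card (nbrs E x \<inter> nbrs E y) - card U \<le> card (nbrs E x \<inter> nbrs E y - U)"
      by (rule diff_card_le_card_Diff[OF finU])
    ultimately show "card T \<le> card (nbrs E x \<inter> nbrs E y - U)"
      using \<open>card T \<le> 2 * r\<^sup>2\<close> U(2) by linarith
  qed auto
  moreover have "isomorphic (grid r) (U, T)"
    using f by (auto simp: isomorphic_def T_def)
  then have "g r \<le> val P (U, T)"
    using minor_bidimensionalD(1)[OF mb] TU finU by (auto simp: ugraph_def)
  ultimately show ?thesis
    by simp
qed

text \<open>The relation \<open>few\<close> is triangle-free on the neighbourhood \<open>H\<close>.
  The bound r^4 <= d makes \<open>H\<close> large enough for an independent set of r^2 vertices;
  9r^2 <= d excludes the triangles.\<close>

lemma val_ge_dense_nbhd: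
  assumes mb: "minor_bidimensional g P" and ug: "ugraph (V, E)"
    and d: "r ^ 4 \<le> d" "9 * r\<^sup>2 \<le> d"
    and deg: "d \<le> card (nbrs E v)" "card (nbrs E v) \<le> 2 * d"
    and tri: "\<And>u. u \<in> nbrs E v \<Longrightarrow> d \<le> card (nbrs E u \<inter> nbrs E v)"
  shows "g r \<le> val P (V, E)"
proof -
  define H where "H = nbrs E v"
  define few where "few x y \<longleftrightarrow> card (nbrs E x \<inter> nbrs E y) < 3 * r\<^sup>2" for x y
  have finH: "finite H"
    unfolding H_def using finite_nbrs[OF ug] .
  have "symp few"
    by (auto simp: few_def Int_commute intro!: sympI)
  moreover have "(r\<^sup>2)\<^sup>2 \<le> card H"
    using d deg by (simp add: H_def power_mult[symmetric])
  moreover have "\<not> few y z" if xyz: "x \<in> H" "y \<in> H" "z \<in> H" "few x y" "few x z" for x y z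
  proof
    assume "few y z"
    have le: "card ((nbrs E a \<inter> H) \<inter> (nbrs E b \<inter> H)) \<le> card (nbrs E a \<inter> nbrs E b)" for a b
      using finite_nbrs[OF ug] by (intro card_mono) auto
    have "d \<le> card (nbrs E x \<inter> H)" "d \<le> card (nbrs E y \<inter> H)" "d \<le> card (nbrs E z \<inter> H)"
      using xyz tri by (auto simp: H_def)
    moreover have "card H \<le> 2 * d"
      using deg by (simp add: H_def)
    \<comment> \<open>Three pairwise small intersections would give 3d < 2d + 9r^2 <= 3d.\<close>
    ultimately show False
      using card_three_sets[OF finH, of "nbrs E x \<inter> H" "nbrs E y \<inter> H" "nbrs E z \<inter> H",
          OF Int_lower2 Int_lower2 Int_lower2]
        le[of x y] le[of x z] le[of y z] xyz(4,5) \<open>few y z\<close> d(2)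
      unfolding few_def by linarith
  qed
  ultimately have "\<exists>U \<subseteq> H. card U = r\<^sup>2 \<and> (\<forall>x\<in>U. \<forall>y\<in>U. x \<noteq> y \<longrightarrow> \<not> few x y)"
    by (intro triangle_free_independent[OF finH])
  then obtain U where U: "U \<subseteq> H" "card U = r\<^sup>2" "\<forall>x\<in>U. \<forall>y\<in>U. x \<noteq> y \<longrightarrow> \<not> few x y"
    by blast
  show ?thesis
  proof (rule val_ge_if_common_nbrs[OF mb ug])
    show "U \<subseteq> V"
      using U(1) nbrs_subset[OF ug] by (auto simp: H_def)
  qed (use U in \<open>auto simp: few_def not_less\<close>)
qed

text \<open>Induction on \<open>card V + card E\<close> stands in for the choice of a minimal minor:
  any deletion or contraction that keeps \<open>d\<close> edges per vertex is settled by the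
  induction hypothesis and monotonicity.\<close>

lemma val_ge_if_many_edges:
  assumes mb: "minor_bidimensional g P" and r: "0 < r"
    and "ugraph (V, E)" "V \<noteq> {}" "9 * r ^ 4 * card V \<le> card E"
  shows "g r \<le> val P (V, E)"
  using assms(3-)
proof (induction "card V + card E" arbitrary: V E rule: less_induct)
  case less
  define d where "d = 9 * r ^ 4"
  note ug = less.prems(1)
  have finV: "finite V" and finE: "finite E"
    using ug ugraph_finite_edges[OF ug] by (simp_all add: ugraph_def)
  have dE: "d * card V \<le> card E"
    using less.prems by (simp add: d_def)
  have "0 < d"
    using r by (simp add: d_def)
  moreover have "0 < card V"
    using less.prems finV by (simp add: card_gt_0_iff)
  ultimately have "0 < card E"
    using dE by (meson less_le_trans nat_0_less_mult_iff)
  then obtain e where e: "e \<in> E"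
    by (auto simp: card_gt_0_iff)
  obtain x y where xy: "{x, y} \<in> E" "x \<in> V" "y \<in> V" "x \<noteq> y"
    using ugraph_edgeE[OF ug e] e by blast
  \<comment> \<open>An edge has two ends, so removing one vertex keeps the graph nonempty, as the
    induction hypothesis requires.\<close>
  have ne: "V - {v} \<noteq> {}" for v
    using xy by auto
  \<comment> \<open>Removing one vertex pays for the loss of up to \<open>d\<close> edges.\<close>
  have smaller: "d * card (V - {v}) \<le> m" if "v \<in> V" "card E \<le> m + d" for v m
  proof -
    have "card V = Suc (card (V - {v}))"
      using that finV by (intro card.remove)
    then have "d * card (V - {v}) + d \<le> card E"
      using dE by (metis add.commute mult_Suc_right)
    then show ?thesis
      using that by linarith
  qed
  consider (edge) "d * card V < card E"
    | (vertex) v where "v \<in> V" "card (nbrs E v) < d"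
    | (contract) u v where "{u, v} \<in> E" "card (nbrs E u \<inter> nbrs E v) < d"
    | (dense) "card E = d * card V" "\<And>v. v \<in> V \<Longrightarrow> d \<le> card (nbrs E v)"
        "\<And>u v. {u, v} \<in> E \<Longrightarrow> d \<le> card (nbrs E u \<inter> nbrs E v)"
    using dE by (meson le_antisym not_le)
  then show ?case
  proof cases
    case edge
    have "card (E - {e}) = card E - 1"
      using e by simp
    then have "g r \<le> val P (V, E - {e})"
      using edge less.prems(2) ugraph_subset[OF ug, of "E - {e}"] \<open>0 < card E\<close>
      by (intro less.hyps) (simp_all add: d_def)
    also have "\<dots> \<le> val P (V, E)"
      using minor_bidimensionalD(3)[OF mb ug] e by (simp add: delete_edge_def)
    finally show ?thesis .
  next
    case vertex
    define E' where "E' = {e \<in> E. v \<notin> e}"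
    have G': "delete_vertex v (V, E) = (V - {v}, E')"
      by (simp add: delete_vertex_def E'_def)
    have "card E = card E' + card (nbrs E v)"
      unfolding E'_def by (rule card_split_incident[OF ug])
    moreover have "card (V - {v}) < card V"
      using vertex finV by (meson card_Diff1_less)
    ultimately have "g r \<le> val P (V - {v}, E')"
      using vertex ne smaller[of v "card E'"] ugraph_delete_vertex[OF ug, of v]
      by (intro less.hyps) (simp_all add: d_def G')
    also have "\<dots> \<le> val P (V, E)"
      using minor_bidimensionalD(2)[OF mb ug, of v] vertex by (simp add: G')
    finally show ?thesis .
  next
    case contract
    define E' where "E' = edges (contract_edge u v (V, E))"
    have G': "contract_edge u v (V, E) = (V - {v}, E')"
      by (simp add: contract_edge_def E'_def)
    have v: "v \<in> V"
      using ugraph_edgeD[OF ug contract(1)] by simp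
    \<comment> \<open>Fewer than \<open>d\<close> common neighbours leave room for the contracted
      edge itself.\<close>
    have "card E \<le> card E' + d"
      using card_edges_contract_edge[OF ug contract(1)] contract(2) by (simp add: E'_def)
    moreover have "card E' \<le> card E"
    proof -
      have "card E' \<le> card ((\<lambda>e. (\<lambda>x. if x = v then u else x) ` e) ` E)"
        using finE by (intro card_mono) (auto simp: E'_def contract_edge_def)
      also have "\<dots> \<le> card E"
        by (rule card_image_le[OF finE])
      finally show ?thesis .
    qed
    moreover have "card (V - {v}) < card V"
      using v finV by (meson card_Diff1_less)
    ultimately have "g r \<le> val P (V - {v}, E')"
      using ne v smaller[of v "card E'"] ugraph_contract_edge[OF ug contract(1)]
      by (intro less.hyps) (simp_all add: d_def G')
    also have "\<dots> \<le> val P (V, E)"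
      using minor_bidimensionalD(4)[OF mb ug, of u v] contract by (simp add: G')
    finally show ?thesis .
  next
    case dense
    \<comment> \<open>Equality in the edge count makes the average degree exactly
      \<open>2 * d\<close>.\<close>
    obtain v where v: "v \<in> V" "card (nbrs E v) \<le> 2 * d"
    proof (rule ccontr)
      assume "\<not> thesis"
      then have "\<And>v. v \<in> V \<Longrightarrow> 2 * d < card (nbrs E v)"
        using that by force
      then have "(\<Sum>v\<in>V. 2 * d) < (\<Sum>v\<in>V. card (nbrs E v))"
        using finV less.prems by (intro sum_strict_mono) auto
      then show False
        using handshake[OF ug] dense(1) by simp
    qed
    have "r\<^sup>2 \<le> r ^ 4"
      using r by (intro power_increasing) auto
    then have "r ^ 4 \<le> d" "9 * r\<^sup>2 \<le> d"
      by (simp_all add: d_def)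
    then show ?thesis
    proof (rule val_ge_dense_nbhd[OF mb ug _ _ dense(2)[OF v(1)] v(2)])
      fix u assume "u \<in> nbrs E v"
      then show "d \<le> card (nbrs E u \<inter> nbrs E v)"
        by (intro dense(3)) (simp add: nbrs_def insert_commute)
    qed
  qed
qed

section \<open>Streaming algorithms with few states\<close>

text \<open>States are stored under an injective code by strings of \<open>b\<close> bits; since
  computation is unbounded, decoding before each update is free. Validity passes to prefixes, so
  every intermediate state lies in \<open>S\<close>.\<close>

lemma streaming_algorithm_of_states:
  fixes st :: "item list \<Rightarrow> 's"
  assumes S: "finite S" "card S \<le> 2 ^ b"
    and valid: "\<And>xs x. valid (xs @ [x]) \<Longrightarrow> valid xs"
    and mem: "\<And>xs. valid xs \<Longrightarrow> st xs \<in> S"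
    and upd: "\<And>xs x. valid (xs @ [x]) \<Longrightarrow> st (xs @ [x]) = f (st xs) x"
    and ans: "\<And>xs. valid xs \<Longrightarrow> a (st xs) \<longleftrightarrow> Q xs"
  shows "\<exists>A. \<forall>xs. valid xs \<longrightarrow>
    (\<forall>i \<le> length xs. length (run A (take i xs)) = b) \<and> (answer A (run A xs) \<longleftrightarrow> Q xs)"
proof -
  have "card {bs :: bool list. length bs = b} = 2 ^ b" "finite {bs :: bool list. length bs = b}"
    using card_lists_length_eq[of "UNIV :: bool set" b]
      finite_lists_length_eq[of "UNIV :: bool set" b] by auto
  then obtain c where c: "inj_on c S" "c ` S \<subseteq> {bs :: bool list. length bs = b}"
    using S card_le_inj by metis
  let ?dec = "inv_into S c"
  define A where "A = \<lparr>init = c (st []), step = (\<lambda>m x. c (f (?dec m) x)), answer = (\<lambda>m. a (?dec m))\<rparr>"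
  have dec: "?dec (c s) = s" if "s \<in> S" for s
    using c(1) that by simp
  have run: "run A xs = c (st xs)" if "valid xs" for xs
    using that
  proof (induction xs rule: rev_induct)
    case (snoc x xs)
    then have "valid xs"
      using valid by blast
    then show ?case
      using snoc upd[OF snoc.prems] dec[OF mem] by (simp add: run_def A_def)
  qed (simp add: run_def A_def)
  have "valid (take i xs)" if "valid xs" for i xs
    using that
  proof (induction xs rule: rev_induct)
    case (snoc x xs)
    then show ?case
      using valid[of xs x] by (cases "i \<le> length xs") auto
  qed simp
  then have "length (run A (take i xs)) = b" if "valid xs" for i xs
    using that run[of "take i xs"] mem[of "take i xs"] c(2) by auto
  moreover have "answer A (run A xs) \<longleftrightarrow> Q xs" if "valid xs" for xs
    using run[OF that] dec[OF mem[OF that]] ans[OF that] by (simp add: A_def)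
  ultimately show ?thesis
    by blast
qed

text \<open>A small subset is listed by a word of length exactly \<open>m\<close> over
  \<open>A\<close> and the padding letter \<open>None\<close>.\<close>

lemma card_small_subsets:
  assumes "finite A"
  shows "card {X. X \<subseteq> A \<and> card X \<le> m} \<le> Suc (card A) ^ m"
proof -
  let ?B = "insert None (Some ` A)"
  let ?L = "{xs. set xs \<subseteq> ?B \<and> length xs = m}"
  let ?f = "\<lambda>xs. {x. Some x \<in> set xs}"
  have "{X. X \<subseteq> A \<and> card X \<le> m} \<subseteq> ?f ` ?L"
  proof
    fix X assume X: "X \<in> {X. X \<subseteq> A \<and> card X \<le> m}"
    then have "finite X"
      using assms finite_subset by auto
    then obtain ys where ys: "set ys = X" "distinct ys"
      using finite_distinct_list by auto
    let ?xs = "map Some ys @ replicate (m - length ys) None"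
    have "length ys \<le> m"
      using X ys distinct_card by fastforce
    then have "?xs \<in> ?L"
      using X ys by auto
    moreover have "X = ?f ?xs"
      using ys by auto
    ultimately show "X \<in> ?f ` ?L"
      by blast
  qed
  moreover have fin: "finite ?L"
    using assms by (intro finite_lists_length_eq) auto
  ultimately have "card {X. X \<subseteq> A \<and> card X \<le> m} \<le> card ?L"
    by (meson card_image_le card_mono finite_imageI le_trans)
  also have "\<dots> = card ?B ^ m"
    using assms by (intro card_lists_length_eq) auto
  also have "card ?B = Suc (card A)"
    using assms by (subst card_insert_disjoint) (auto simp: card_image)
  finally show ?thesis .
qed

text \<open>The weights are chosen greedily: a new weight must avoid the differences of sums over two
  small subsets of the elements treated so far.\<close>

lemma exists_sum_injective_weights:
  fixes M :: int
  assumes "finite A" "int ((card {X. X \<subseteq> A \<and> card X \<le> m})\<^sup>2) < M"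
  shows "\<exists>h. \<forall>X Y. X \<subseteq> A \<and> card X \<le> m \<and> Y \<subseteq> A \<and> card Y \<le> m \<and>
    sum h X mod M = sum h Y mod M \<longrightarrow> X = Y"
proof -
  define K where "K B = {X. X \<subseteq> B \<and> card X \<le> m}" for B :: "'a set"
  have "\<exists>h. \<forall>X\<in>K B. \<forall>Y\<in>K B. sum h X mod M = sum h Y mod M \<longrightarrow> X = Y"
    if "finite B" "B \<subseteq> A" for B
    using that
  proof (induction B rule: finite_induct)
    case empty
    then show ?case
      by (auto simp: K_def)
  next
    case (insert b B)
    then obtain h where h: "\<And>X Y. X \<in> K B \<Longrightarrow> Y \<in> K B \<Longrightarrow> sum h X mod M = sum h Y mod M \<Longrightarrow> X = Y"
      by auto
    \<comment> \<open>Forbidden weights for \<open>b\<close>: equal sums over a set containing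
      \<open>b\<close> and one avoiding it would force the weight to be such a residue.\<close>
    define D where "D = (\<lambda>(X, Y). (sum h Y - sum h X) mod M) ` (K B \<times> K B)"
    have "K B \<subseteq> K A" "finite (K A)"
      using insert.prems assms(1) by (auto simp: K_def intro: finite_subset[of _ "Pow A"])
    then have fin: "finite (K B)" and "card (K B) \<le> card (K A)"
      by (auto intro: finite_subset card_mono)
    have "card D \<le> card (K B) * card (K B)"
      unfolding D_def using card_image_le[of "K B \<times> K B"] fin by (simp add: card_cartesian_product)
    \<comment> \<open>Passing from \<open>B\<close> to \<open>A\<close> lets one modulus serve every
      stage of the induction.\<close>
    also have "\<dots> \<le> card (K A) * card (K A)"
      using \<open>card (K B) \<le> card (K A)\<close> by (intro mult_mono) auto
    finally have "int (card D) \<le> int ((card (K A))\<^sup>2)"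
      by (simp only: of_nat_le_iff power2_eq_square)
    then have "int (card D) < M"
      using assms(2) unfolding K_def by linarith
    then have "card D < card {0..<M}"
      by simp
    then have "\<not> {0..<M} \<subseteq> D"
      using fin by (metis D_def card_mono finite_SigmaI finite_imageI not_le)
    then obtain c where c: "0 \<le> c" "c < M" "c \<notin> D"
      by (meson atLeastLessThan_iff subsetI)
    let ?h = "h(b := c)"
    have sum_old: "sum ?h X = sum h X" if "b \<notin> X" for X
      using that by (intro sum.cong) auto
    have sum_new: "sum ?h X = c + sum h (X - {b})" if "b \<in> X" "X \<in> K (insert b B)" for X
    proof -
      have "finite X"
        using that insert.hyps by (auto simp: K_def intro: finite_subset)
      then show ?thesis
        using that sum_old[of "X - {b}"] by (simp add: sum.remove)
    qed
    have small: "X - {b} \<in> K B" if "X \<in> K (insert b B)" for X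
      using that by (auto simp: K_def intro: order_trans[OF card_Diff1_le])
    have mixed: False
      if XY: "X \<in> K (insert b B)" "Y \<in> K (insert b B)" "b \<in> X" "b \<notin> Y"
        and eq: "sum ?h X mod M = sum ?h Y mod M" for X Y
    proof -
      have "(c + sum h (X - {b})) mod M = sum h Y mod M"
        using eq XY sum_old sum_new by simp
      then have "(c + sum h (X - {b}) - sum h (X - {b})) mod M = (sum h Y - sum h (X - {b})) mod M"
        by (rule mod_diff_cong) simp
      then have "c = (sum h Y - sum h (X - {b})) mod M"
        using c by simp
      moreover have "Y \<in> K B"
        using small[OF XY(2)] XY(4) by simp
      ultimately have "c \<in> D"
        using small[OF XY(1)] unfolding D_def by force
      then show False
        using c by simp
    qed
    have "X = Y"
      if XY: "X \<in> K (insert b B)" "Y \<in> K (insert b B)"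
        and eq: "sum ?h X mod M = sum ?h Y mod M" for X Y
    proof -
      \<comment> \<open>In the remaining cases \<open>c\<close> cancels or does not occur, and
        injectivity of the old weights applies.\<close>
      consider "b \<in> X" "b \<in> Y" | "b \<notin> X" "b \<notin> Y"
        using mixed[OF XY _ _ eq] mixed[OF XY(2,1) _ _ eq[symmetric]] by blast
      then show ?thesis
      proof cases
        case 1
        then have "(c + sum h (X - {b})) mod M = (c + sum h (Y - {b})) mod M"
          using eq XY sum_new by simp
        then have "(c + sum h (X - {b}) - c) mod M = (c + sum h (Y - {b}) - c) mod M"
          by (rule mod_diff_cong) simp
        then have "X - {b} = Y - {b}"
          using h small XY by simp
        then show ?thesis
          using 1 by auto
      next
        case 2
        then show ?thesis
          using h[of X Y] small[OF XY(1)] small[OF XY(2)] eq sum_old by simp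
      qed
    qed
    then show ?case
      by (intro exI[of _ ?h]) blast
  qed
  from this[OF assms(1) subset_refl] obtain h
    where "\<forall>X\<in>K A. \<forall>Y\<in>K A. sum h X mod M = sum h Y mod M \<longrightarrow> X = Y"
    by blast
  then show ?thesis
    unfolding K_def by (intro exI[of _ h]) simp
qed

section \<open>Streams\<close>

lemma stream_graph_Nil: "stream_graph n [] = ({..<n}, {})"
  by (simp add: stream_graph_def)

lemma edges_stream_graph_snoc:
  "edges (stream_graph n (xs @ [x])) = apply_item (edges (stream_graph n xs)) x"
  by (simp add: stream_graph_def)

lemma stream_graph_eq: "stream_graph n xs = ({..<n}, edges (stream_graph n xs))"
  by (simp add: stream_graph_def)

lemma insertion_only_snoc:
  "insertion_only_stream n (xs @ [x]) \<longleftrightarrow>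
     insertion_only_stream n xs \<and> x \<in> Ins ` all_edges {..<n}"
  by (auto simp: insertion_only_stream_def)

lemma insertion_deletion_snoc:
  "insertion_deletion_stream n (xs @ [x]) \<longleftrightarrow>
     insertion_deletion_stream n xs \<and> legal_item n (edges (stream_graph n xs)) x"
  by (auto simp: insertion_deletion_stream_def nth_append less_Suc_eq)

lemma insertion_only_edges:
  "insertion_only_stream n xs \<Longrightarrow> edges (stream_graph n xs) \<subseteq> all_edges {..<n}"
  by (induction xs rule: rev_induct)
    (auto simp: stream_graph_Nil edges_stream_graph_snoc insertion_only_snoc)

lemma insertion_deletion_edges:
  "insertion_deletion_stream n xs \<Longrightarrow> edges (stream_graph n xs) \<subseteq> all_edges {..<n}"
proof (induction xs rule: rev_induct)
  case (snoc x xs)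
  then show ?case
    by (cases x) (auto simp: edges_stream_graph_snoc insertion_deletion_snoc)
qed (simp add: stream_graph_Nil)

text \<open>The ends of an edge differ, so the pair \<open>(0, 0)\<close> is spare and leaves room
  for the successor.\<close>

lemma Suc_card_all_edges: "0 < n \<Longrightarrow> Suc (card (all_edges {..<n})) \<le> n\<^sup>2"
proof -
  assume "0 < n"
  have "all_edges {..<n} \<subseteq> (\<lambda>(x, y). {x, y}) ` ({..<n} \<times> {..<n} - {(0, 0)})"
  proof
    fix e assume "e \<in> all_edges {..<n}"
    then obtain x y where "e = {x, y}" "x \<in> {..<n}" "y \<in> {..<n}" "x \<noteq> y"
      by (rule all_edgesE)
    then show "e \<in> (\<lambda>(x, y). {x, y}) ` ({..<n} \<times> {..<n} - {(0, 0)})"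
      by (intro image_eqI[of _ _ "(x, y)"]) auto
  qed
  then have "card (all_edges {..<n}) \<le> card ({..<n} \<times> {..<n} - {(0, 0)})"
    by (meson card_image_le card_mono finite_Diff finite_SigmaI finite_imageI finite_lessThan le_trans)
  also have "\<dots> = n * n - 1"
    using \<open>0 < n\<close> by (subst card_Diff_singleton) auto
  moreover have "0 < n * n"
    using \<open>0 < n\<close> by simp
  ultimately show ?thesis
    unfolding power2_eq_square by linarith
qed

text \<open>Since \<open>lg n\<close> is at least 1, rounding the logarithm up costs at most a
  factor of 2.\<close>

lemma lg_ceiling:
  assumes "0 < n"
  obtains q :: nat where "n \<le> 2 ^ q" "real q \<le> 2 * lg n"
proof -
  define q where "q = nat \<lceil>log 2 (real n)\<rceil>"
  have "0 \<le> log 2 (real n)"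
    using assms by simp
  then have q: "log 2 (real n) \<le> real q" "real q \<le> log 2 (real n) + 1"
    unfolding q_def by linarith+
  have "real n = 2 powr log 2 (real n)"
    using assms by simp
  also have "\<dots> \<le> 2 powr real q"
    using q by simp
  also have "\<dots> = real (2 ^ q)"
    by (simp add: powr_realpow)
  finally have "n \<le> 2 ^ q"
    using of_nat_le_iff by blast
  moreover have "real q \<le> 2 * lg n"
    using q by (auto simp: lg_def)
  ultimately show ?thesis
    using that by blast
qed

lemma card_small_edge_sets:
  fixes n :: nat
  assumes "0 < n" "n \<le> 2 ^ q"
  shows "card {E. E \<subseteq> all_edges {..<n} \<and> card E \<le> m} \<le> 2 ^ (2 * q * m)"
proof -
  have "card {E. E \<subseteq> all_edges {..<n} \<and> card E \<le> m} \<le> Suc (card (all_edges {..<n})) ^ m"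
    by (intro card_small_subsets finite_all_edges finite_lessThan)
  also have "\<dots> \<le> ((2 ^ q)\<^sup>2) ^ m"
    by (intro power_mono le_trans[OF Suc_card_all_edges] assms) auto
  also have "\<dots> = 2 ^ (2 * q * m)"
    by (simp add: power_mult[symmetric] mult.commute mult.left_commute)
  finally show ?thesis .
qed

text \<open>The state is the edge set itself, or \<open>None\<close> once \<open>m\<close> edges are
  reached; from then on the answer is \<open>c\<close>. Repeated insertions are harmless because a
  set is stored.\<close>

lemma insertion_only_states:
  assumes n: "0 < n" "n \<le> 2 ^ q"
    and dense: "\<And>E. E \<subseteq> all_edges {..<n} \<Longrightarrow> m \<le> card E \<Longrightarrow> Q ({..<n}, E) \<longleftrightarrow> c"
  shows "\<exists>A. \<forall>xs. insertion_only_stream n xs \<longrightarrow>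
    (\<forall>i \<le> length xs. length (run A (take i xs)) = 1 + 2 * q * m) \<and>
    (answer A (run A xs) \<longleftrightarrow> Q (stream_graph n xs))"
proof -
  define S where "S = {E. E \<subseteq> all_edges {..<n} \<and> card E \<le> m}"
  define tr where "tr E = (if card E < m then Some E else None)" for E :: "nat set set"
  let ?E = "\<lambda>xs. edges (stream_graph n xs)"
  have fin: "finite (all_edges {..<n})"
    by (simp add: finite_all_edges)
  then have "finite S"
    by (auto simp: S_def intro: finite_subset[of _ "Pow (all_edges {..<n})"])
  show ?thesis
  proof (rule streaming_algorithm_of_states[where S = "insert None (Some ` S)" and st = "\<lambda>xs. tr (?E xs)"
        and f = "\<lambda>s x. case s of None \<Rightarrow> None | Some E \<Rightarrow> tr (apply_item E x)"
        and a = "\<lambda>s. case s of None \<Rightarrow> c | Some E \<Rightarrow> Q ({..<n}, E)"])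
    have "card (insert None (Some ` S)) = Suc (card S)"
      using \<open>finite S\<close> by (subst card_insert_disjoint) (auto simp: card_image)
    \<comment> \<open>The overflow state costs at most one additional bit.\<close>
    also have "\<dots> \<le> 2 * 2 ^ (2 * q * m)"
      using card_small_edge_sets[OF n, of m] one_le_power[of "2 :: nat" "2 * q * m"]
      unfolding S_def by linarith
    finally show "card (insert None (Some ` S)) \<le> 2 ^ (1 + 2 * q * m)"
      by simp
  next
    fix xs x assume valid: "insertion_only_stream n (xs @ [x])"
    then have "?E (xs @ [x]) \<subseteq> all_edges {..<n}"
      by (rule insertion_only_edges)
    then have "finite (?E (xs @ [x]))"
      using fin finite_subset by blast
    \<comment> \<open>The edge set never shrinks, so \<open>None\<close> need never be left.\<close>
    moreover have "?E xs \<subseteq> ?E (xs @ [x])"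
      using valid by (auto simp: insertion_only_snoc edges_stream_graph_snoc)
    ultimately have "card (?E xs) \<le> card (?E (xs @ [x]))"
      by (rule card_mono)
    then show "tr (?E (xs @ [x])) =
        (case tr (?E xs) of None \<Rightarrow> None | Some E \<Rightarrow> tr (apply_item E x))"
      by (auto simp: tr_def edges_stream_graph_snoc)
  next
    fix xs assume "insertion_only_stream n xs"
    then have "m \<le> card (?E xs) \<Longrightarrow> Q ({..<n}, ?E xs) \<longleftrightarrow> c"
      by (intro dense insertion_only_edges)
    then show "(case tr (?E xs) of None \<Rightarrow> c | Some E \<Rightarrow> Q ({..<n}, E)) \<longleftrightarrow> Q (stream_graph n xs)"
      by (subst stream_graph_eq) (simp add: tr_def)
  qed (use \<open>finite S\<close> insertion_only_edges in \<open>auto simp: insertion_only_snoc tr_def S_def\<close>)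
qed

text \<open>The pair of weight sum and edge count can be updated in both directions even while the
  graph is dense; whenever the count is below \<open>m\<close>, the sum determines the edge
  set.\<close>

lemma insertion_deletion_states:
  assumes n: "0 < n" "n \<le> 2 ^ q"
    and dense: "\<And>E. E \<subseteq> all_edges {..<n} \<Longrightarrow> m \<le> card E \<Longrightarrow> Q ({..<n}, E) \<longleftrightarrow> c"
  shows "\<exists>A. \<forall>xs. insertion_deletion_stream n xs \<longrightarrow>
    (\<forall>i \<le> length xs. length (run A (take i xs)) = 1 + 4 * q * m + 2 * q) \<and>
    (answer A (run A xs) \<longleftrightarrow> Q (stream_graph n xs))"
proof -
  \<comment> \<open>At most 2^(2qm) small edge sets exist; \<open>M\<close> exceeds the square of
    this number, as the choice of weights demands.\<close>
  define M :: int where "M = 2 ^ (1 + 4 * q * m)"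
  let ?E = "\<lambda>xs. edges (stream_graph n xs)"
  have fin: "finite (all_edges {..<n})"
    by (simp add: finite_all_edges)
  have "(card {E. E \<subseteq> all_edges {..<n} \<and> card E \<le> m})\<^sup>2 \<le> (2 ^ (2 * q * m))\<^sup>2"
    by (intro power_mono card_small_edge_sets[OF n]) auto
  also have "\<dots> = 2 ^ (4 * q * m)"
    by (simp add: power_mult[symmetric])
  also have "\<dots> < 2 ^ (1 + 4 * q * m)"
    by simp
  finally have "int ((card {E. E \<subseteq> all_edges {..<n} \<and> card E \<le> m})\<^sup>2) < M"
    unfolding M_def by (metis of_nat_less_iff of_nat_numeral of_nat_power)
  then obtain h where h: "\<And>X Y. X \<subseteq> all_edges {..<n} \<Longrightarrow> card X \<le> m \<Longrightarrow>
      Y \<subseteq> all_edges {..<n} \<Longrightarrow> card Y \<le> m \<Longrightarrow> sum h X mod M = sum h Y mod M \<Longrightarrow> X = Y"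
    using exists_sum_injective_weights[OF fin, of m M] by metis
  define st where "st E = (sum h E mod M, card E)" for E
  define f where "f s x = (case x of Ins e \<Rightarrow> ((fst s + h e) mod M, snd s + 1)
    | Del e \<Rightarrow> ((fst s - h e) mod M, snd s - 1))" for s :: "int \<times> nat" and x
  \<comment> \<open>The existential decodes the sketch by exhaustive search; the weights make the
    witness unique.\<close>
  define a where "a s \<longleftrightarrow> (if snd s < m
    then \<exists>E \<subseteq> all_edges {..<n}. st E = s \<and> Q ({..<n}, E) else c)" for s
  have "0 < M"
    by (simp add: M_def)
  let ?S = "{0..<M} \<times> {..card (all_edges {..<n})}"
  show ?thesis
  proof (rule streaming_algorithm_of_states[where S = ?S and st = "\<lambda>xs. st (?E xs)" and f = f and a = a])
    have "card ?S = 2 ^ (1 + 4 * q * m) * Suc (card (all_edges {..<n}))"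
      by (simp add: M_def card_cartesian_product nat_power_eq nat_mult_distrib)
    \<comment> \<open>The edge counter accounts for the last factor, that is, for
      \<open>2 * q\<close> bits.\<close>
    also have "\<dots> \<le> 2 ^ (1 + 4 * q * m) * (2 ^ q)\<^sup>2"
      by (intro mult_left_mono le_trans[OF Suc_card_all_edges] power_mono n) auto
    also have "\<dots> = 2 ^ (1 + 4 * q * m + 2 * q)"
      by (simp add: power_add power_mult[symmetric] mult.commute)
    finally show "card ?S \<le> 2 ^ (1 + 4 * q * m + 2 * q)" .
  next
    fix xs assume "insertion_deletion_stream n xs"
    then show "st (?E xs) \<in> ?S"
      using insertion_deletion_edges[of n xs] fin \<open>0 < M\<close> by (auto simp: st_def intro: card_mono)
  next
    fix xs x assume valid: "insertion_deletion_stream n (xs @ [x])"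
    then have "finite (?E xs)"
      using insertion_deletion_edges fin finite_subset by (metis insertion_deletion_snoc)
    \<comment> \<open>Legality ensures that an inserted edge is absent and a deleted one present, so
      sum and count change by exactly that edge.\<close>
    then show "st (?E (xs @ [x])) = f (st (?E xs)) x"
      using valid
      by (cases x) (auto simp: st_def f_def edges_stream_graph_snoc insertion_deletion_snoc
          sum_diff1 mod_simps add.commute)
  next
    fix xs assume "insertion_deletion_stream n xs"
    then have E: "?E xs \<subseteq> all_edges {..<n}"
      by (rule insertion_deletion_edges)
    show "a (st (?E xs)) \<longleftrightarrow> Q (stream_graph n xs)"
    proof (cases "card (?E xs) < m")
      case True
      then have "E' = ?E xs" if "E' \<subseteq> all_edges {..<n}" "st E' = st (?E xs)" for E'
        using that E by (intro h) (auto simp: st_def)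
      then have "a (st (?E xs)) \<longleftrightarrow> Q ({..<n}, ?E xs)"
        using True E by (auto simp: a_def st_def)
      then show ?thesis
        using stream_graph_eq[of n xs] by simp
    next
      case False
      then show ?thesis
        using dense[OF E] stream_graph_eq[of n xs] by (simp add: a_def st_def)
    qed
  qed (auto simp: insertion_deletion_snoc)
qed

text \<open>Serves \<open>n = 0\<close> and \<open>ginv (k + 1) = 0\<close>, where the claimed bound
  is zero and no bit may be stored.\<close>

lemma constant_algorithm:
  "\<exists>A. \<forall>xs. (\<forall>i \<le> length xs. length (run A (take i xs)) = 0) \<and> (answer A (run A xs) \<longleftrightarrow> c)"
proof -
  let ?A = "\<lparr>init = [], step = (\<lambda>_ _. []), answer = (\<lambda>_. c)\<rparr>"
  have "run ?A xs = []" for xs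
    by (cases xs rule: rev_cases) (auto simp: run_def)
  then show ?thesis
    by (intro exI[of _ ?A]) simp
qed

text \<open>A value of at least \<open>k + 1\<close> settles both kinds of problem, which is why
  \<open>ginv\<close> is evaluated at \<open>k + 1\<close>.\<close>

lemma k_problem_if_large: "k < val P G \<Longrightarrow> k_problem P k G \<longleftrightarrow> goal P = Maximization"
  by (cases "goal P") (auto simp: k_problem_def)

text \<open>Common to both stream models: \<open>states\<close> turns a threshold \<open>m\<close>,
  above which the answer is constant, into an algorithm, and the grid bound supplies m = 9r^4
  n.\<close>

lemma solvable_in_spaceI:
  assumes ib: "inverse_bound g ginv" and mb: "minor_bidimensional g P"
    and edges: "\<And>n xs. valid n xs \<Longrightarrow> edges (stream_graph n xs) \<subseteq> all_edges {..<n}"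
    and empty: "\<And>xs. valid 0 xs \<Longrightarrow> xs = []"
    and states: "\<And>n q m Q c. 0 < n \<Longrightarrow> n \<le> 2 ^ q \<Longrightarrow>
      (\<And>E. E \<subseteq> all_edges {..<n} \<Longrightarrow> m \<le> card E \<Longrightarrow> Q ({..<n}, E) \<longleftrightarrow> c) \<Longrightarrow>
      \<exists>A. \<forall>xs. valid n xs \<longrightarrow>
        (\<forall>i \<le> length xs. length (run A (take i xs)) = b q m) \<and>
        (answer A (run A xs) \<longleftrightarrow> Q (stream_graph n xs))"
    and b: "\<And>q m. b q m \<le> 1 + 4 * q * m + 2 * q"
  shows "solvable_in_space valid P (\<lambda>n k. 117 * real (ginv (k + 1)) ^ 10 * real n)"
proof -
  have "\<exists>A. \<forall>xs. valid n xs \<longrightarrow>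
      (\<forall>i \<le> length xs. real (length (run A (take i xs))) \<le>
        117 * real (ginv (k + 1)) ^ 10 * real n * lg n) \<and>
      (answer A (run A xs) \<longleftrightarrow> k_problem P k (stream_graph n xs))" for n k
  proof -
    define r where "r = ginv (k + 1)"
    have gr: "k < g r"
      using ib unfolding inverse_bound_def r_def by (metis Suc_eq_plus1 Suc_le_eq)
    have lg: "1 \<le> lg n"
      by (simp add: lg_def)
    consider "n = 0" | "r = 0" | "0 < n" "0 < r"
      by auto
    then show ?thesis
    proof cases
      case 1
      then show ?thesis
        using empty constant_algorithm[of "k_problem P k (stream_graph n [])"] by fastforce
    next
      case 2
      have "k_problem P k (stream_graph n xs) \<longleftrightarrow> goal P = Maximization" if "valid n xs" for xs
      proof (rule k_problem_if_large)
        \<comment> \<open>The empty graph is the 0 x 0 grid and a subgraph of every graph, so all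
          values exceed \<open>k\<close>.\<close>
        have "isomorphic (grid 0) (({}, {}) :: nat ugraph)"
          by (auto simp: isomorphic_def grid_def bij_betw_def)
        then have "g 0 \<le> val P ({}, {})"
          by (intro minor_bidimensionalD(1)[OF mb]) (auto simp: ugraph_def)
        also have "\<dots> \<le> val P ({..<n}, edges (stream_graph n xs))"
          using edges[OF that] by (intro val_subgraph[OF mb]) (auto simp: ugraph_def)
        finally show "k < val P (stream_graph n xs)"
          using gr 2 stream_graph_eq[of n xs] by simp
      qed
      then show ?thesis
        using constant_algorithm[of "goal P = Maximization"] 2 by (fastforce simp: r_def)
    next
      case 3
      define m where "m = 9 * r ^ 4 * n"
      have "0 < m"
        using 3 by (simp add: m_def)
      obtain q :: nat where q: "n \<le> 2 ^ q" "real q \<le> 2 * lg n"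
        using lg_ceiling[OF 3(1)] .
      have "k_problem P k ({..<n}, E) \<longleftrightarrow> goal P = Maximization"
        if "E \<subseteq> all_edges {..<n}" "m \<le> card E" for E
      proof (rule k_problem_if_large)
        have "g r \<le> val P ({..<n}, E)"
          using that 3 by (intro val_ge_if_many_edges[OF mb]) (auto simp: ugraph_def m_def)
        then show "k < val P ({..<n}, E)"
          using gr by simp
      qed
      then have "\<exists>A. \<forall>xs. valid n xs \<longrightarrow>
          (\<forall>i \<le> length xs. length (run A (take i xs)) = b q m) \<and>
          (answer A (run A xs) \<longleftrightarrow> k_problem P k (stream_graph n xs))"
        by (rule states[OF 3(1) q(1)])
      moreover have "real (b q m) \<le> 117 * real r ^ 10 * real n * lg n"
      proof -
        have "real (b q m) \<le> real (1 + 4 * q * m + 2 * q)"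
          using b of_nat_le_iff by blast
        also have "\<dots> = 1 + real q * (4 * real m + 2)"
          by (simp add: algebra_simps)
        \<comment> \<open>In total 13 m lg n bits, and 13 * 9 = 117.\<close>
        also have "\<dots> \<le> lg n * real m + 2 * lg n * (6 * real m)"
        proof (intro add_mono mult_mono)
          show "1 \<le> lg n * real m"
            using mult_mono[of 1 "lg n" 1 "real m"] lg \<open>0 < m\<close> by simp
        qed (use q lg \<open>0 < m\<close> in auto)
        also have "\<dots> = 117 * real r ^ 4 * (real n * lg n)"
          by (simp add: m_def algebra_simps)
        \<comment> \<open>The fourth power is weakened to the claimed tenth, using \<open>r\<close>
          >= 1.\<close>
        also have "\<dots> \<le> 117 * real r ^ 10 * (real n * lg n)"
          using lg 3 by (intro mult_right_mono mult_left_mono power_increasing) auto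
        finally show ?thesis
          by (simp add: mult.assoc)
      qed
      ultimately show ?thesis
        unfolding r_def by metis
    qed
  qed
  then show ?thesis
    unfolding solvable_in_space_def by metis
qed

theorem theorem18:
  fixes g ginv :: "nat \<Rightarrow> nat" and P :: graph_problem
  assumes "inverse_bound g ginv"
    and "minor_bidimensional g P"
  shows "(\<exists>C. solvable_in_space insertion_only_stream P
            (\<lambda>n k. C * real (ginv (k + 1)) ^ 10 * real n)) \<and>
         (\<exists>C c. solvable_in_space insertion_deletion_stream P
            (\<lambda>n k. C * real (ginv (k + 1)) ^ 10 * real n * lg n ^ c))"
proof -
  have no_edges: "all_edges {..<0 :: nat} = {}"
    by (auto simp: all_edges_def)
  have "solvable_in_space insertion_only_stream P
      (\<lambda>n k. 117 * real (ginv (k + 1)) ^ 10 * real n)"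
  proof (rule solvable_in_spaceI[where b = "\<lambda>q m. 1 + 2 * q * m",
        OF assms insertion_only_edges _ insertion_only_states])
    fix xs assume "insertion_only_stream 0 xs"
    then show "xs = []"
      using no_edges by (simp add: insertion_only_stream_def)
  qed auto
  \<comment> \<open>The bound in words is the same with deletions, so the logarithmic factor gets
    exponent 0.\<close>
  moreover have "solvable_in_space insertion_deletion_stream P
      (\<lambda>n k. 117 * real (ginv (k + 1)) ^ 10 * real n * lg n ^ 0)"
    unfolding power_0 mult_1_right
  proof (rule solvable_in_spaceI[where b = "\<lambda>q m. 1 + 4 * q * m + 2 * q",
        OF assms insertion_deletion_edges _ insertion_deletion_states])
    fix xs assume valid: "insertion_deletion_stream 0 xs"
    show "xs = []"
    proof (cases xs)
      case (Cons x ys)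
      then have "legal_item 0 {} x"
        using valid by (force simp: insertion_deletion_stream_def stream_graph_def)
      then show ?thesis
        using no_edges by (cases x) auto
    qed simp
  qed auto
  ultimately show ?thesis
    by blast
qed

end
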